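(* The following two assertions are equivalent. (A) For every non-empty compact convex subset $X$ of a Hausdorff topological vector space and every function $f:X\times X\to\mathbb{R}$ such that (i) for each $y\in X$, $f(\cdot,y)$ is lower semicontinuous, and (ii) for each $x\in X$, $f(x,\cdot)$ is quasi-concave, one has \[ \min_{x\in X}\sup_{y\in X} f(x,y)\leq \sup_{x\in X} f(x,x). \] (B) For every non-empty compact convex subset $X$ of a Hausdorff topological vector space and all functions $f,g:X\times X\to\mathbb{R}$ such that (i) $f(x,y)\leq g(x,y)$ for all $x,y\in X$, (ii) for each $y\in X$, $f(\cdot,y)$ is lower pseudo-continuous, (iii) for each $x\in X$, $g(x,\cdot)$ is quasi-concave, and (iv) $f(x,x)=g(x,x)=0$ for all $x\in X$, there exists $x_0\in X$ such that $f(x_0,y)\leq 0$ for all $y\in X$.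
   Context: Vector spaces are real. Assertion (A) is Ky Fan's minimax inequality (suprema are taken in $\mathbb{R}\cup\{+\infty\}$) and assertion (B) is a theorem of Qiu and Peng. A function $f:Z\to\mathbb{R}$ on a topological space $Z$ is lower pseudo-continuous if for all $x,y\in Z$ with $f(x)>f(y)$ there is a neighbourhood $V$ of $x$ with $f(x')>f(y)$ for all $x'\in V$. A function $h:X\to\mathbb{R}$ on a convex set $X$ is quasi-concave if $\{x\in X: h(x)\geq\lambda\}$ is convex for every $\lambda\in\mathbb{R}$. *)

theory Defs
  imports "HOL-Analysis.Analysis" "HOL-Algebra.Algebraic_Closure_Type"
begin

text \<open>
  Topological vector spaces are given by an explicit carrier, explicit operations and an explicit
  topology, so that a formula can quantify over all spaces with carrier inside a given type, which type
  classes would not allow.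
  The fields \<open>mult\<close> and \<open>one\<close> that the record type \<open>module\<close> inherits from rings are unconstrained.
\<close>

locale hausdorff_tvs = Module.module "ring_of_type_algebra :: real ring" V
  for V :: "(real, 'v) module" (structure) +
  fixes T :: "'v topology"
  assumes topspace_eq_carrier: "topspace T = carrier V"
    and Hausdorff: "Hausdorff_space T"
    and continuous_add:
      "continuous_map (prod_topology T T) T (\<lambda>(x, y). x \<oplus> y)"
    and continuous_smult:
      "continuous_map (prod_topology euclideanreal T) T (\<lambda>(a, x). a \<odot> x)"

definition convex_in :: "(real, 'v) module \<Rightarrow> 'v set \<Rightarrow> bool" where
  "convex_in V C \<longleftrightarrow> C \<subseteq> carrier V \<and>
    (\<forall>x\<in>C. \<forall>y\<in>C. \<forall>u\<ge>0. \<forall>v\<ge>0. u + v = 1 \<longrightarrow>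
      (u \<odot>\<^bsub>V\<^esub> x) \<oplus>\<^bsub>V\<^esub> (v \<odot>\<^bsub>V\<^esub> y) \<in> C)"

definition lower_semicontinuous :: "'a topology \<Rightarrow> ('a \<Rightarrow> real) \<Rightarrow> bool" where
  "lower_semicontinuous Z h \<longleftrightarrow> (\<forall>a. openin Z {x \<in> topspace Z. a < h x})"

definition lower_pseudo_continuous :: "'a topology \<Rightarrow> ('a \<Rightarrow> real) \<Rightarrow> bool" where
  "lower_pseudo_continuous Z h \<longleftrightarrow>
    (\<forall>x\<in>topspace Z. \<forall>y\<in>topspace Z. h y < h x \<longrightarrow>
      (\<exists>U. openin Z U \<and> x \<in> U \<and> (\<forall>x'\<in>U. h y < h x')))"

definition quasi_concave_on :: "(real, 'v) module \<Rightarrow> 'v set \<Rightarrow> ('v \<Rightarrow> real) \<Rightarrow> bool" where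
  "quasi_concave_on V K h \<longleftrightarrow> (\<forall>c. convex_in V {x \<in> K. c \<le> h x})"

end

theory Submission
  imports Defs
begin

text \<open>
  Both directions keep the space \<open>V\<close>, the topology and the set \<open>K\<close>, and only change the bifunctions.

  From the minimax inequality to the two-function theorem: pseudo-continuity of \<open>f(\<cdot>, y)\<close> and
  \<open>f y y = 0\<close> are just enough to make \<open>{x. 0 < f x y}\<close> open. Let \<open>H x\<close> be the convex hull of
  \<open>{z. 0 < f x z}\<close>, and apply the minimax inequality to the indicator \<open>F x y\<close> of \<open>y \<in> H x\<close>. It is
  quasi-concave in \<open>y\<close> because \<open>H x\<close> is convex. It is lower semicontinuous in \<open>x\<close> because taking
  convex hulls preserves openness of the fibres \<open>{x. y \<in> H x}\<close> (lemma \<open>openin_hull_fibre\<close>). It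
  vanishes on the diagonal because \<open>H x\<close> lies in the convex set \<open>{z. 0 < g x z}\<close>, which misses \<open>x\<close>.
  Hence some \<open>H x\<^sub>0\<close> is empty, which is the conclusion.

  Conversely, if the supremum \<open>s\<close> of \<open>f\<close> on the diagonal is finite, apply the two-function theorem
  with \<open>max (f x y - s) 0\<close> in both roles: subtracting \<open>s\<close> makes the diagonal nonpositive, cutting at
  \<open>0\<close> makes it zero, and neither spoils semicontinuity or quasi-concavity. The resulting point
  \<open>x\<^sub>0\<close> has \<open>f x\<^sub>0 y \<le> s\<close> for all \<open>y\<close>. That the minimum is attained is a separate compactness
  argument (lemma \<open>SUP_lower_semicontinuous_attains_min\<close>).
\<close>

section \<open>Convex sets\<close>

lemma convex_in_empty: "convex_in V {}"
  by (simp add: convex_in_def)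

lemma convex_in_Inter:
  assumes "\<C> \<noteq> {}" and "\<And>C. C \<in> \<C> \<Longrightarrow> convex_in V C"
  shows "convex_in V (\<Inter>\<C>)"
  unfolding convex_in_def
proof (intro conjI ballI allI impI)
  show "\<Inter>\<C> \<subseteq> carrier V" using assms by (auto simp: convex_in_def)
next
  fix x y and u v :: real
  assume *: "x \<in> \<Inter>\<C>" "y \<in> \<Inter>\<C>" "0 \<le> u" "0 \<le> v" "u + v = 1"
  show "u \<odot>\<^bsub>V\<^esub> x \<oplus>\<^bsub>V\<^esub> v \<odot>\<^bsub>V\<^esub> y \<in> \<Inter>\<C>"
  proof
    fix C assume "C \<in> \<C>"
    then show "u \<odot>\<^bsub>V\<^esub> x \<oplus>\<^bsub>V\<^esub> v \<odot>\<^bsub>V\<^esub> y \<in> C"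
      using assms(2)[of C] * by (simp add: convex_in_def)
  qed
qed

lemma convex_in_hull:
  assumes "convex_in V K" and "S \<subseteq> K"
  shows "convex_in V (convex_in V hull S)"
  unfolding hull_def using assms by (intro convex_in_Inter) auto

lemma quasi_concave_on_strict_superlevel:
  assumes "quasi_concave_on V K h"
  shows "convex_in V {x \<in> K. c < h x}"
proof -
  have level: "convex_in V {x \<in> K. d \<le> h x}" for d
    using assms by (simp add: quasi_concave_on_def)
  have "u \<odot>\<^bsub>V\<^esub> x \<oplus>\<^bsub>V\<^esub> v \<odot>\<^bsub>V\<^esub> y \<in> {z \<in> K. c < h z}"
    if xy: "x \<in> {z \<in> K. c < h z}" "y \<in> {z \<in> K. c < h z}"
      and uv: "0 \<le> u" "0 \<le> v" "u + v = 1" for x y u v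
  proof -
    let ?d = "min (h x) (h y)"
    have "x \<in> {z \<in> K. ?d \<le> h z}" "y \<in> {z \<in> K. ?d \<le> h z}" using xy by auto
    then have "u \<odot>\<^bsub>V\<^esub> x \<oplus>\<^bsub>V\<^esub> v \<odot>\<^bsub>V\<^esub> y \<in> {z \<in> K. ?d \<le> h z}"
      using level[of ?d] uv unfolding convex_in_def by blast
    then show ?thesis using xy by auto
  qed
  moreover have "{x \<in> K. c < h x} \<subseteq> carrier V"
  proof
    fix x assume "x \<in> {x \<in> K. c < h x}"
    then show "x \<in> carrier V" using level[of c] by (auto simp: convex_in_def)
  qed
  ultimately show ?thesis unfolding convex_in_def by blast
qed

text \<open>
  A convex combination of points of \<open>\<Phi> x\<close> involves finitely many of them, and these stay in
  \<open>\<Phi> x'\<close> for \<open>x'\<close> near \<open>x\<close>. Finite combinations can be avoided: the points that lie in the hull of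
  \<open>\<Phi> x'\<close> for all \<open>x'\<close> near \<open>x\<close> form a convex set containing \<open>\<Phi> x\<close>, hence containing its hull.
\<close>
lemma openin_hull_fibre:
  assumes K: "convex_in V K"
    and sub: "\<And>x. x \<in> topspace Z \<Longrightarrow> \<Phi> x \<subseteq> K"
    and op: "\<And>z. z \<in> K \<Longrightarrow> openin Z {x \<in> topspace Z. z \<in> \<Phi> x}"
  shows "openin Z {x \<in> topspace Z. y \<in> convex_in V hull \<Phi> x}"
proof (subst openin_subopen, intro ballI)
  fix x assume "x \<in> {x \<in> topspace Z. y \<in> convex_in V hull \<Phi> x}"
  then have x: "x \<in> topspace Z" and y: "y \<in> convex_in V hull \<Phi> x" by auto
  define N where "N = {z. \<exists>U. openin Z U \<and> x \<in> U \<and> (\<forall>x'\<in>U. z \<in> convex_in V hull \<Phi> x')}"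
  have conv: "convex_in V (convex_in V hull \<Phi> x')" if "x' \<in> topspace Z" for x'
    using convex_in_hull K sub that by blast
  have "\<Phi> x \<subseteq> N"
  proof
    fix z assume z: "z \<in> \<Phi> x"
    have "z \<in> K" using sub x z by blast
    then have "openin Z {x \<in> topspace Z. z \<in> \<Phi> x}" by (rule op)
    then show "z \<in> N"
      unfolding N_def using x z hull_subset[of "\<Phi> _" "convex_in V"] by blast
  qed
  moreover have "convex_in V N"
    unfolding convex_in_def
  proof (intro conjI ballI allI impI)
    show "N \<subseteq> carrier V"
      unfolding N_def using conv[OF x] by (auto simp: convex_in_def)
  next
    fix p q and u v :: real
    assume pq: "p \<in> N" "q \<in> N" and uv: "0 \<le> u" "0 \<le> v" "u + v = 1"
    obtain P where P: "openin Z P" "x \<in> P" "\<And>x'. x' \<in> P \<Longrightarrow> p \<in> convex_in V hull \<Phi> x'"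
      using pq(1) unfolding N_def by blast
    obtain Q where Q: "openin Z Q" "x \<in> Q" "\<And>x'. x' \<in> Q \<Longrightarrow> q \<in> convex_in V hull \<Phi> x'"
      using pq(2) unfolding N_def by blast
    have "u \<odot>\<^bsub>V\<^esub> p \<oplus>\<^bsub>V\<^esub> v \<odot>\<^bsub>V\<^esub> q \<in> convex_in V hull \<Phi> x'" if "x' \<in> P \<inter> Q" for x'
    proof -
      have "x' \<in> topspace Z" using that P(1) openin_subset by blast
      then show ?thesis using conv[of x'] P(3) Q(3) that uv unfolding convex_in_def by blast
    qed
    moreover have "openin Z (P \<inter> Q)" "x \<in> P \<inter> Q" using P Q by auto
    ultimately show "u \<odot>\<^bsub>V\<^esub> p \<oplus>\<^bsub>V\<^esub> v \<odot>\<^bsub>V\<^esub> q \<in> N" unfolding N_def by blast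
  qed
  ultimately have "convex_in V hull \<Phi> x \<subseteq> N" by (rule hull_minimal)
  then obtain U where "openin Z U" "x \<in> U" "\<forall>x'\<in>U. y \<in> convex_in V hull \<Phi> x'"
    using y unfolding N_def by blast
  then show "\<exists>U. openin Z U \<and> x \<in> U \<and> U \<subseteq> {x \<in> topspace Z. y \<in> convex_in V hull \<Phi> x}"
    using openin_subset by blast
qed

section \<open>Semicontinuity\<close>

lemma lower_semicontinuous_imp_lower_pseudo_continuous:
  assumes "lower_semicontinuous Z h"
  shows "lower_pseudo_continuous Z h"
  unfolding lower_pseudo_continuous_def
proof (intro ballI impI)
  fix x y assume "x \<in> topspace Z" "h y < h x"
  then show "\<exists>U. openin Z U \<and> x \<in> U \<and> (\<forall>x'\<in>U. h y < h x')"
    using assms unfolding lower_semicontinuous_def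
    by (intro exI[of _ "{x \<in> topspace Z. h y < h x}"]) auto
qed

lemma lower_pseudo_continuous_openin_attained_value:
  assumes "lower_pseudo_continuous Z h" and "y \<in> topspace Z"
  shows "openin Z {x \<in> topspace Z. h y < h x}"
proof (subst openin_subopen, intro ballI)
  fix x assume "x \<in> {x \<in> topspace Z. h y < h x}"
  then obtain U where "openin Z U" "x \<in> U" "\<forall>x'\<in>U. h y < h x'"
    using assms unfolding lower_pseudo_continuous_def by blast
  then show "\<exists>U. openin Z U \<and> x \<in> U \<and> U \<subseteq> {x \<in> topspace Z. h y < h x}"
    using openin_subset by blast
qed

text \<open>
  If no point were a minimum, every point would lie in a set \<open>{x. a < h i x}\<close> whose level \<open>a\<close> is
  strictly above some value of the supremum. Among finitely many such sets covering the space, the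
  smallest level is a strict lower bound of the supremum, although it lies above one of its values.
\<close>
lemma SUP_lower_semicontinuous_attains_min:
  fixes h :: "'i \<Rightarrow> 'a \<Rightarrow> real"
  assumes Z: "compact_space Z" "topspace Z \<noteq> {}"
    and lsc: "\<And>i. i \<in> I \<Longrightarrow> lower_semicontinuous Z (h i)"
  shows "\<exists>x\<^sub>0\<in>topspace Z. \<forall>x\<in>topspace Z. (SUP i\<in>I. ereal (h i x\<^sub>0)) \<le> (SUP i\<in>I. ereal (h i x))"
proof (rule ccontr)
  define \<phi> where "\<phi> x = (SUP i\<in>I. ereal (h i x))" for x
  define P where "P = {(i, a). i \<in> I \<and> (\<exists>x'\<in>topspace Z. \<phi> x' < ereal a)}"
  define U where "U p = {x \<in> topspace Z. snd p < h (fst p) x}" for p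
  assume "\<not> ?thesis"
  then have none: "\<exists>x'\<in>topspace Z. \<phi> x' < \<phi> x" if "x \<in> topspace Z" for x
    using that by (force simp: \<phi>_def not_le)
  have "topspace Z \<subseteq> \<Union>(U ` P)"
  proof
    fix x assume x: "x \<in> topspace Z"
    obtain x' where x': "x' \<in> topspace Z" "\<phi> x' < \<phi> x" using none x by blast
    obtain i where i: "i \<in> I" "\<phi> x' < ereal (h i x)"
      using x'(2) unfolding \<phi>_def[of x] less_SUP_iff by blast
    obtain a where "\<phi> x' < ereal a" "ereal a < ereal (h i x)" using ereal_dense2 i(2) by blast
    then have "(i, a) \<in> P" "x \<in> U (i, a)" using i x' x by (auto simp: P_def U_def)
    then show "x \<in> \<Union>(U ` P)" by blast
  qed
  moreover have "openin Z W" if "W \<in> U ` P" for W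
    using that lsc by (auto simp: P_def U_def lower_semicontinuous_def)
  ultimately obtain \<F> where \<F>: "finite \<F>" "\<F> \<subseteq> U ` P" "topspace Z \<subseteq> \<Union>\<F>"
    using Z(1) unfolding compact_space_alt by metis
  obtain Q where Q: "Q \<subseteq> P" "finite Q" "\<F> = U ` Q" using \<F> finite_subset_image by metis
  have "Q \<noteq> {}" using Z(2) \<F>(3) Q(3) by auto
  then obtain p where p: "p \<in> Q" "\<And>q. q \<in> Q \<Longrightarrow> snd p \<le> snd q"
    using Q(2) ex_min_if_finite[of "snd ` Q"]
    by (metis (no_types, lifting) image_iff image_is_empty finite_imageI not_le)
  obtain x where x: "x \<in> topspace Z" "\<phi> x < ereal (snd p)" using p(1) Q(1) by (auto simp: P_def)
  obtain q where q: "q \<in> Q" "x \<in> U q" using x \<F>(3) Q(3) by blast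
  have "fst q \<in> I" using q Q(1) by (auto simp: P_def)
  then have "ereal (h (fst q) x) \<le> \<phi> x" unfolding \<phi>_def by (rule SUP_upper)
  moreover have "snd p < h (fst q) x" using p(2)[OF q(1)] q(2) by (simp add: U_def)
  ultimately show False using x(2) by (metis less_ereal.simps(1) order_less_le_trans order_less_asym)
qed

section \<open>The two implications\<close>

lemma equilibrium_if_minimax:
  fixes V :: "(real, 'v) module" and f g :: "'v \<Rightarrow> 'v \<Rightarrow> real"
  assumes minimax: "\<And>F :: 'v \<Rightarrow> 'v \<Rightarrow> real.
      \<forall>y\<in>K. lower_semicontinuous (subtopology T K) (\<lambda>x. F x y) \<Longrightarrow>
      \<forall>x\<in>K. quasi_concave_on V K (\<lambda>y. F x y) \<Longrightarrow>
      \<exists>x\<^sub>0\<in>K. (SUP y\<in>K. ereal (F x\<^sub>0 y)) \<le> (SUP x\<in>K. ereal (F x x))"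
    and KT: "K \<subseteq> topspace T" and convex: "convex_in V K"
    and le: "\<forall>x\<in>K. \<forall>y\<in>K. f x y \<le> g x y"
    and lpc: "\<forall>y\<in>K. lower_pseudo_continuous (subtopology T K) (\<lambda>x. f x y)"
    and qc: "\<forall>x\<in>K. quasi_concave_on V K (\<lambda>y. g x y)"
    and diag: "\<forall>x\<in>K. f x x = 0 \<and> g x x = 0"
  shows "\<exists>x\<^sub>0\<in>K. \<forall>y\<in>K. f x\<^sub>0 y \<le> 0"
proof -
  let ?Z = "subtopology T K"
  have top: "topspace ?Z = K" using KT by auto
  define \<Phi> where "\<Phi> x = {z \<in> K. 0 < f x z}" for x
  define H where "H x = convex_in V hull \<Phi> x" for x
  define F :: "'v \<Rightarrow> 'v \<Rightarrow> real" where "F x y = (if y \<in> H x then 1 else 0)" for x y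
  have \<Phi>K: "\<Phi> x \<subseteq> K" for x by (auto simp: \<Phi>_def)
  have HK: "H x \<subseteq> K" for x unfolding H_def using \<Phi>K convex by (intro hull_minimal)
  have fibre: "openin ?Z {x \<in> topspace ?Z. y \<in> H x}" for y
    unfolding H_def
  proof (rule openin_hull_fibre[OF convex \<Phi>K])
    fix z assume z: "z \<in> K"
    then have "openin ?Z {x \<in> topspace ?Z. f z z < f x z}"
      using lpc top by (intro lower_pseudo_continuous_openin_attained_value) auto
    then show "openin ?Z {x \<in> topspace ?Z. z \<in> \<Phi> x}" using z diag by (simp add: \<Phi>_def)
  qed
  have "lower_semicontinuous ?Z (\<lambda>x. F x y)" for y
    unfolding lower_semicontinuous_def
  proof
    fix a
    have "{x \<in> topspace ?Z. a < F x y} =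
        (if a < 0 then topspace ?Z else if a < 1 then {x \<in> topspace ?Z. y \<in> H x} else {})"
      by (auto simp: F_def)
    then show "openin ?Z {x \<in> topspace ?Z. a < F x y}"
      using fibre by (simp del: topspace_subtopology split: if_split)
  qed
  moreover have "quasi_concave_on V K (\<lambda>y. F x y)" for x
    unfolding quasi_concave_on_def
  proof
    fix c
    have "{y \<in> K. c \<le> F x y} = (if c \<le> 0 then K else if c \<le> 1 then H x else {})"
      using HK by (auto simp: F_def)
    moreover have "convex_in V (H x)" unfolding H_def by (rule convex_in_hull[OF convex \<Phi>K])
    ultimately show "convex_in V {y \<in> K. c \<le> F x y}"
      using convex by (simp add: convex_in_empty split: if_split)
  qed
  ultimately obtain x0 where x0: "x0 \<in> K" "(SUP y\<in>K. ereal (F x0 y)) \<le> (SUP x\<in>K. ereal (F x x))"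
    using minimax by blast
  have "F x x = 0" if x: "x \<in> K" for x
  proof -
    have "\<Phi> x \<subseteq> {z \<in> K. 0 < g x z}" using le x by (force simp: \<Phi>_def)
    then have "H x \<subseteq> {z \<in> K. 0 < g x z}"
      unfolding H_def using qc x by (intro hull_minimal quasi_concave_on_strict_superlevel) auto
    then show ?thesis using diag x by (auto simp: F_def)
  qed
  then have sup: "(SUP x\<in>K. ereal (F x x)) \<le> 0" by (intro SUP_least) simp
  have "f x0 y \<le> 0" if y: "y \<in> K" for y
  proof (rule ccontr)
    assume "\<not> f x0 y \<le> 0"
    then have "y \<in> H x0"
      using y hull_subset[of "\<Phi> x0" "convex_in V"] by (auto simp: \<Phi>_def H_def)
    then have "ereal 1 \<le> (SUP y\<in>K. ereal (F x0 y))"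
      using y by (intro SUP_upper2[of y]) (auto simp: F_def)
    then have "ereal 1 \<le> 0" using x0(2) sup by (meson order_trans)
    then show False by simp
  qed
  then show ?thesis using x0(1) by blast
qed

lemma minimax_if_equilibrium:
  fixes V :: "(real, 'v) module" and f :: "'v \<Rightarrow> 'v \<Rightarrow> real"
  assumes equilibrium: "\<And>F :: 'v \<Rightarrow> 'v \<Rightarrow> real.
      \<forall>y\<in>K. lower_pseudo_continuous (subtopology T K) (\<lambda>x. F x y) \<Longrightarrow>
      \<forall>x\<in>K. quasi_concave_on V K (\<lambda>y. F x y) \<Longrightarrow>
      \<forall>x\<in>K. F x x = 0 \<Longrightarrow> \<exists>x\<^sub>0\<in>K. \<forall>y\<in>K. F x\<^sub>0 y \<le> 0"
    and K: "K \<noteq> {}" and compact: "compactin T K" and convex: "convex_in V K"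
    and lsc: "\<forall>y\<in>K. lower_semicontinuous (subtopology T K) (\<lambda>x. f x y)"
    and qc: "\<forall>x\<in>K. quasi_concave_on V K (\<lambda>y. f x y)"
  shows "\<exists>x\<^sub>0\<in>K. (\<forall>x\<in>K. (SUP y\<in>K. ereal (f x\<^sub>0 y)) \<le> (SUP y\<in>K. ereal (f x y))) \<and>
    (SUP y\<in>K. ereal (f x\<^sub>0 y)) \<le> (SUP x\<in>K. ereal (f x x))"
proof -
  let ?Z = "subtopology T K"
  have top: "topspace ?Z = K" using compactin_subset_topspace[OF compact] by auto
  have "compact_space ?Z" using compact by (simp add: compactin_subspace)
  then obtain x0 where x0: "x0 \<in> K"
      "\<forall>x\<in>K. (SUP y\<in>K. ereal (f x0 y)) \<le> (SUP y\<in>K. ereal (f x y))"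
    using SUP_lower_semicontinuous_attains_min[of ?Z K "\<lambda>y x. f x y"] K lsc top by auto
  have "\<exists>x\<in>K. (SUP y\<in>K. ereal (f x y)) \<le> (SUP x\<in>K. ereal (f x x))"
  proof (cases "(SUP x\<in>K. ereal (f x x)) = \<infinity>")
    case True
    then show ?thesis using K by auto
  next
    case False
    moreover have "(SUP x\<in>K. ereal (f x x)) \<noteq> -\<infinity>"
    proof -
      have "ereal (f x0 x0) \<le> (SUP x\<in>K. ereal (f x x))" using x0(1) by (rule SUP_upper)
      then show ?thesis by auto
    qed
    ultimately obtain s where s: "(SUP x\<in>K. ereal (f x x)) = ereal s" by (metis ereal_cases)
    have fs: "f x x \<le> s" if "x \<in> K" for x
      using SUP_upper[OF that, of "\<lambda>x. ereal (f x x)"] s by simp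
    define F where "F x y = max (f x y - s) 0" for x y
    have "lower_semicontinuous ?Z (\<lambda>x. F x y)" if "y \<in> K" for y
      unfolding lower_semicontinuous_def
    proof
      fix a
      have "{x \<in> topspace ?Z. a < F x y} =
          (if a < 0 then topspace ?Z else {x \<in> topspace ?Z. a + s < f x y})"
        by (auto simp: F_def)
      then show "openin ?Z {x \<in> topspace ?Z. a < F x y}"
        using lsc that unfolding lower_semicontinuous_def
        by (simp del: topspace_subtopology split: if_split)
    qed
    then have "\<forall>y\<in>K. lower_pseudo_continuous ?Z (\<lambda>x. F x y)"
      using lower_semicontinuous_imp_lower_pseudo_continuous by blast
    moreover have "\<forall>x\<in>K. quasi_concave_on V K (\<lambda>y. F x y)"
      unfolding quasi_concave_on_def
    proof (intro ballI allI)
      fix x c assume x: "x \<in> K"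
      have "{y \<in> K. c \<le> F x y} = (if c \<le> 0 then K else {y \<in> K. c + s \<le> f x y})"
        by (auto simp: F_def)
      then show "convex_in V {y \<in> K. c \<le> F x y}"
        using qc x convex unfolding quasi_concave_on_def by (simp split: if_split)
    qed
    moreover have "\<forall>x\<in>K. F x x = 0" using fs by (simp add: F_def)
    ultimately obtain x1 where x1: "x1 \<in> K" "\<forall>y\<in>K. F x1 y \<le> 0" using equilibrium by blast
    then have "(SUP y\<in>K. ereal (f x1 y)) \<le> ereal s" by (intro SUP_least) (auto simp: F_def)
    then show ?thesis using x1(1) s by auto
  qed
  then show ?thesis using x0 by (meson order_trans)
qed

theorem mainTheorem6:
  shows
    "(\<forall>(V :: (real, 'v) module) (T :: 'v topology) (K :: 'v set) (f :: 'v \<Rightarrow> 'v \<Rightarrow> real).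
        hausdorff_tvs V T \<longrightarrow> K \<noteq> {} \<longrightarrow> compactin T K \<longrightarrow> convex_in V K \<longrightarrow>
        (\<forall>y\<in>K. lower_semicontinuous (subtopology T K) (\<lambda>x. f x y)) \<longrightarrow>
        (\<forall>x\<in>K. quasi_concave_on V K (\<lambda>y. f x y)) \<longrightarrow>
        (\<exists>x\<^sub>0\<in>K.
          (\<forall>x\<in>K. (SUP y\<in>K. ereal (f x\<^sub>0 y)) \<le> (SUP y\<in>K. ereal (f x y))) \<and>
          (SUP y\<in>K. ereal (f x\<^sub>0 y)) \<le> (SUP x\<in>K. ereal (f x x))))
     \<longleftrightarrow>
     (\<forall>(V :: (real, 'v) module) (T :: 'v topology) (K :: 'v set)
        (f :: 'v \<Rightarrow> 'v \<Rightarrow> real) (g :: 'v \<Rightarrow> 'v \<Rightarrow> real).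
        hausdorff_tvs V T \<longrightarrow> K \<noteq> {} \<longrightarrow> compactin T K \<longrightarrow> convex_in V K \<longrightarrow>
        (\<forall>x\<in>K. \<forall>y\<in>K. f x y \<le> g x y) \<longrightarrow>
        (\<forall>y\<in>K. lower_pseudo_continuous (subtopology T K) (\<lambda>x. f x y)) \<longrightarrow>
        (\<forall>x\<in>K. quasi_concave_on V K (\<lambda>y. g x y)) \<longrightarrow>
        (\<forall>x\<in>K. f x x = 0 \<and> g x x = 0) \<longrightarrow>
        (\<exists>x\<^sub>0\<in>K. \<forall>y\<in>K. f x\<^sub>0 y \<le> 0))"
proof (intro iffI allI impI, goal_cases)
  case (1 V T K f g)
  note minimax = 1(1)[THEN spec[of _ V], THEN spec[of _ T], THEN spec[of _ K], THEN spec,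
      THEN mp[OF _ 1(2)], THEN mp[OF _ 1(3)], THEN mp[OF _ 1(4)], THEN mp[OF _ 1(5)],
      THEN mp, THEN mp]
  show ?case
  proof (rule equilibrium_if_minimax[OF _ compactin_subset_topspace[OF 1(4)] 1(5-9)])
    fix F :: "'v \<Rightarrow> 'v \<Rightarrow> real"
    assume "\<forall>y\<in>K. lower_semicontinuous (subtopology T K) (\<lambda>x. F x y)"
      "\<forall>x\<in>K. quasi_concave_on V K (\<lambda>y. F x y)"
    from minimax[OF this]
    show "\<exists>x\<^sub>0\<in>K. (SUP y\<in>K. ereal (F x\<^sub>0 y)) \<le> (SUP x\<in>K. ereal (F x x))"
      by (elim bexE conjE) (rule bexI)
  qed
next
  case (2 V T K f)
  note equilibrium = 2(1)[THEN spec[of _ V], THEN spec[of _ T], THEN spec[of _ K], THEN spec,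
      THEN spec, THEN mp[OF _ 2(2)], THEN mp[OF _ 2(3)], THEN mp[OF _ 2(4)], THEN mp[OF _ 2(5)],
      THEN mp, THEN mp, THEN mp, THEN mp]
  show ?case
  proof (rule minimax_if_equilibrium[OF _ 2(3-7)])
    fix F :: "'v \<Rightarrow> 'v \<Rightarrow> real"
    assume F: "\<forall>y\<in>K. lower_pseudo_continuous (subtopology T K) (\<lambda>x. F x y)"
      "\<forall>x\<in>K. quasi_concave_on V K (\<lambda>y. F x y)" "\<forall>x\<in>K. F x x = 0"
    show "\<exists>x\<^sub>0\<in>K. \<forall>y\<in>K. F x\<^sub>0 y \<le> 0"
      by (rule equilibrium[OF _ F(1) F(2)]) (simp_all add: F(3))
  qed
qed

end
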